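(* For each $N\in\mathbb N$, let $\{a_i^{(N)}\}_{i=1}^N$ be self-adjoint cyclic-Boolean independent elements in a cyclic non-commutative probability space $(\mathcal A_N,\varphi_N,\omega_N)$. Assume that for each fixed $k\in\mathbb N$ the moments $\varphi_N((a_i^{(N)})^k)$ and $\omega_N((a_i^{(N)})^k)$ do not depend on $i$ or $N$, and that $\omega_N(a_i^{(N)})=\varphi_N(a_i^{(N)})=0$ and $\varphi_N((a_i^{(N)})^2)=1$ for all $i$ and $N$. Let $$s_N=\frac{a_1^{(N)}+a_2^{(N)}+\cdots+a_N^{(N)}}{\sqrt N}.$$ Then $$\lim_{N\to\infty}\varphi_N(s_N^k)=\begin{cases}1,&k\in\{2,4,6,\dots\},\\0,&k\in\{1,3,5,\dots\},\end{cases}\qquad \lim_{N\to\infty}\omega_N(s_N^k)=\begin{cases}2,&k\in\{4,6,8,\dots\},\\0,&k\in\{3,5,7,\dots\}.\end{cases}$$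
   Context: $\mathbb N=\{1,2,3,\dots\}$. A cyclic non-commutative probability space is a triple $(\mathcal A,\varphi,\omega)$ where $\mathcal A$ is a (not necessarily unital) $*$-algebra over $\mathbb C$, $\varphi$ is a positive linear functional on $\mathcal A$, and $\omega$ is a positive tracial linear functional on $\mathcal A$ (i.e. $\omega(xy)=\omega(yx)$). A family of $*$-subalgebras $\{\mathcal A_k\}_{k\in K}$ of $\mathcal A$ is cyclic-Boolean independent if: (i) for any $n\ge 2$, any tuple $(k_1,\dots,k_n)\in K^n$ with $k_1\ne k_2\ne\cdots\ne k_n$ and $a_i\in\mathcal A_{k_i}$, one has $\varphi(a_1\cdots a_n)=\varphi(a_1)\cdots\varphi(a_n)$; (ii) for any $n\ge 2$, any tuple $(k_1,\dots,k_n)\in K^n$ with $k_1\ne k_2\ne\cdots\ne k_n\ne k_1$ and $a_i\in\mathcal A_{k_i}$, one has $\omega(a_1\cdots a_n)=\varphi(a_1)\cdots\varphi(a_n)$. A family of elements $\{a_k\}_{k\in K}$ is cyclic-Boolean independent if the family $\{\mathcal A_k\}_{k\in K}$ is, where $\mathcal A_k$ is the $*$-subalgebra generated by $a_k$ without unit. *)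

theory Defs
  imports
    Complex_Main
    "HOL-Algebra.Module"
    "HOL-Algebra.Algebraic_Closure_Type"
    "HOL-Library.Nonpos_Ints"
begin

text \<open>
  Algebras are carrier-based, so that a sequence of spaces may consist of different algebras.
  The inherited field \<^term>\<open>one\<close> of the record is never used: no axiom
  mentions it, since the algebras need not be unital.
\<close>

record 'a star_alg = "(complex, 'a) module" +
  star :: "'a \<Rightarrow> 'a"

locale star_algebra = module "ring_of_type_algebra :: complex ring" A
  for A :: "('a, 'm) star_alg_scheme" (structure) +
  assumes mult_closed: "\<lbrakk>x \<in> carrier A; y \<in> carrier A\<rbrakk> \<Longrightarrow> x \<otimes> y \<in> carrier A"
    and mult_assoc: "\<lbrakk>x \<in> carrier A; y \<in> carrier A; z \<in> carrier A\<rbrakk>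
      \<Longrightarrow> (x \<otimes> y) \<otimes> z = x \<otimes> (y \<otimes> z)"
    and mult_l_distr: "\<lbrakk>x \<in> carrier A; y \<in> carrier A; z \<in> carrier A\<rbrakk>
      \<Longrightarrow> (x \<oplus> y) \<otimes> z = x \<otimes> z \<oplus> y \<otimes> z"
    and mult_r_distr: "\<lbrakk>x \<in> carrier A; y \<in> carrier A; z \<in> carrier A\<rbrakk>
      \<Longrightarrow> z \<otimes> (x \<oplus> y) = z \<otimes> x \<oplus> z \<otimes> y"
    and smult_mult_l: "\<lbrakk>x \<in> carrier A; y \<in> carrier A\<rbrakk> \<Longrightarrow> (c \<odot> x) \<otimes> y = c \<odot> (x \<otimes> y)"
    and smult_mult_r: "\<lbrakk>x \<in> carrier A; y \<in> carrier A\<rbrakk> \<Longrightarrow> x \<otimes> (c \<odot> y) = c \<odot> (x \<otimes> y)"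
    and star_closed: "x \<in> carrier A \<Longrightarrow> star A x \<in> carrier A"
    and star_star: "x \<in> carrier A \<Longrightarrow> star A (star A x) = x"
    and star_add: "\<lbrakk>x \<in> carrier A; y \<in> carrier A\<rbrakk> \<Longrightarrow> star A (x \<oplus> y) = star A x \<oplus> star A y"
    and star_smult: "x \<in> carrier A \<Longrightarrow> star A (c \<odot> x) = cnj c \<odot> star A x"
    and star_mult: "\<lbrakk>x \<in> carrier A; y \<in> carrier A\<rbrakk> \<Longrightarrow> star A (x \<otimes> y) = star A y \<otimes> star A x"

definition linear_functional :: "('a, 'm) star_alg_scheme \<Rightarrow> ('a \<Rightarrow> complex) \<Rightarrow> bool" where
  "linear_functional A f \<longleftrightarrow>
    (\<forall>x\<in>carrier A. \<forall>y\<in>carrier A. f (x \<oplus>\<^bsub>A\<^esub> y) = f x + f y) \<and>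
    (\<forall>c. \<forall>x\<in>carrier A. f (c \<odot>\<^bsub>A\<^esub> x) = c * f x)"

definition positive_functional :: "('a, 'm) star_alg_scheme \<Rightarrow> ('a \<Rightarrow> complex) \<Rightarrow> bool" where
  "positive_functional A f \<longleftrightarrow>
    linear_functional A f \<and> (\<forall>x\<in>carrier A. f (star A x \<otimes>\<^bsub>A\<^esub> x) \<in> \<real>\<^sub>\<ge>\<^sub>0)"

locale cyclic_ncps = star_algebra A
  for A :: "('a, 'm) star_alg_scheme" (structure) +
  fixes \<phi> \<omega> :: "'a \<Rightarrow> complex"
  assumes phi_positive: "positive_functional A \<phi>"
    and omega_positive: "positive_functional A \<omega>"
    and omega_tracial: "\<lbrakk>x \<in> carrier A; y \<in> carrier A\<rbrakk> \<Longrightarrow> \<omega> (x \<otimes> y) = \<omega> (y \<otimes> x)"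

text \<open>
  Products and powers of positive length only, as there need not be a unit.  The values at the
  empty list and at exponent \<open>0\<close> are junk.
\<close>

definition word_prod :: "('a, 'm) star_alg_scheme \<Rightarrow> 'a list \<Rightarrow> 'a" where
  "word_prod A xs = foldl (\<lambda>x y. x \<otimes>\<^bsub>A\<^esub> y) (hd xs) (tl xs)"

definition pos_power :: "('a, 'm) star_alg_scheme \<Rightarrow> 'a \<Rightarrow> nat \<Rightarrow> 'a" where
  "pos_power A x k = word_prod A (replicate k x)"

definition self_adjoint :: "('a, 'm) star_alg_scheme \<Rightarrow> 'a \<Rightarrow> bool" where
  "self_adjoint A x \<longleftrightarrow> x \<in> carrier A \<and> star A x = x"

definition star_subalgebra :: "('a, 'm) star_alg_scheme \<Rightarrow> 'a set \<Rightarrow> bool" where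
  "star_subalgebra A H \<longleftrightarrow>
    H \<subseteq> carrier A \<and> \<zero>\<^bsub>A\<^esub> \<in> H \<and>
    (\<forall>x\<in>H. \<forall>y\<in>H. x \<oplus>\<^bsub>A\<^esub> y \<in> H) \<and>
    (\<forall>c. \<forall>x\<in>H. c \<odot>\<^bsub>A\<^esub> x \<in> H) \<and>
    (\<forall>x\<in>H. \<forall>y\<in>H. x \<otimes>\<^bsub>A\<^esub> y \<in> H) \<and>
    (\<forall>x\<in>H. star A x \<in> H)"

definition gen_star_subalgebra :: "('a, 'm) star_alg_scheme \<Rightarrow> 'a \<Rightarrow> 'a set" where
  "gen_star_subalgebra A x = \<Inter> {H. star_subalgebra A H \<and> x \<in> H}"

text \<open>
  A tuple of indices is a list \<open>ks\<close>, and \<open>distinct_adj\<close> says that neighbouring entries differ.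
\<close>

definition cyclic_boolean_indep ::
  "('a, 'm) star_alg_scheme \<Rightarrow> ('a \<Rightarrow> complex) \<Rightarrow> ('a \<Rightarrow> complex) \<Rightarrow> 'k set \<Rightarrow> ('k \<Rightarrow> 'a set) \<Rightarrow> bool"
where
  "cyclic_boolean_indep A \<phi> \<omega> K B \<longleftrightarrow>
    (\<forall>k\<in>K. star_subalgebra A (B k)) \<and>
    (\<forall>ks xs. length ks \<ge> 2 \<and> set ks \<subseteq> K \<and> distinct_adj ks \<and>
        list_all2 (\<lambda>x k. x \<in> B k) xs ks \<longrightarrow>
        \<phi> (word_prod A xs) = prod_list (map \<phi> xs)) \<and>
    (\<forall>ks xs. length ks \<ge> 2 \<and> set ks \<subseteq> K \<and> distinct_adj ks \<and> last ks \<noteq> hd ks \<and>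
        list_all2 (\<lambda>x k. x \<in> B k) xs ks \<longrightarrow>
        \<omega> (word_prod A xs) = prod_list (map \<phi> xs))"

definition cyclic_boolean_indep_elems ::
  "('a, 'm) star_alg_scheme \<Rightarrow> ('a \<Rightarrow> complex) \<Rightarrow> ('a \<Rightarrow> complex) \<Rightarrow> 'k set \<Rightarrow> ('k \<Rightarrow> 'a) \<Rightarrow> bool"
where
  "cyclic_boolean_indep_elems A \<phi> \<omega> K a \<longleftrightarrow>
    cyclic_boolean_indep A \<phi> \<omega> K (\<lambda>k. gen_star_subalgebra A (a k))"

end

theory Submission
  imports Defs
begin

text \<open>
  Expanding \<open>s_N^k\<close> turns both functionals into sums over words of length \<open>k\<close> in the letters
  \<open>1, ..., N\<close>.  Cut a word into its maximal runs of equal letters.  Boolean independence makes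
  \<open>\<phi>\<close> of a word the product of the moments \<open>m p = \<phi>(a_i^p)\<close> of its runs, and these do not depend
  on the letters.  So the sum over all words is governed by a recursion on the length of the first
  run: choosing its letter gives a factor of order \<open>N\<close>, and normalising its length \<open>p\<close> gives
  \<open>N^(-p/2)\<close>.  Since \<open>N^(1 - p/2) * m p\<close> vanishes for \<open>p = 1\<close> (the letters are centred),
  equals \<open>1\<close> for \<open>p = 2\<close>, and tends to \<open>0\<close> for \<open>p > 2\<close>, only words made of pairs
  survive.  Hence in the limit the \<open>k\<close>-th moment under \<open>\<phi>\<close> equals the \<open>(k - 2)\<close>-nd one
  (\<open>boolean_sum_tendsto\<close> and \<open>scaled_phi_moment_tendsto\<close>).

  For \<open>\<omega>\<close> words are read on a circle, by traciality: the first run and the last run merge when they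
  carry the same letter \<open>i\<close>.  A word \<open>i^p u i^q\<close> whose middle part \<open>u\<close> neither starts nor ends
  with \<open>i\<close> contributes \<open>m (p + q) * \<phi>(u)\<close>.  Here the merged run has length \<open>p + q = 2\<close> in the limit,
  and with \<open>p \<ge> 1\<close> this happens in two ways, \<open>(1, 1)\<close> and \<open>(2, 0)\<close>; that is where the
  value \<open>2\<close> comes from (\<open>sum_Omega_words\<close> and \<open>scaled_omega_moment_tendsto\<close>).  Forbidding the last
  letter of \<open>u\<close> to be \<open>i\<close> does not change the limit, since it costs no factor \<open>N\<close>
  (\<open>two_sided_sum_tendsto\<close>).  Words with a single run contribute \<open>N^(1 - k/2) * \<omega>(a_i^k)\<close>, which
  tends to \<open>0\<close> because \<open>k \<ge> 3\<close>.

  The recursions are exact for each \<open>N\<close>.  Since they refer only to the numbers \<open>m p\<close> and \<open>N\<close>, the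
  sums are the same for every letter \<open>i\<close>, and no uniformity in \<open>i\<close> has to be tracked in the limit.
\<close>

section \<open>Words grouped by runs of a letter\<close>

definition words :: "'k set \<Rightarrow> nat \<Rightarrow> 'k list set" where
  "words I k = {u. set u \<subseteq> I \<and> length u = k}"

definition words_not_from :: "'k set \<Rightarrow> 'k \<Rightarrow> nat \<Rightarrow> 'k list set" where
  "words_not_from I i k = {u \<in> words I k. u \<noteq> [] \<and> hd u \<noteq> i}"

definition words_avoiding_ends :: "'k set \<Rightarrow> 'k \<Rightarrow> nat \<Rightarrow> 'k list set" where
  "words_avoiding_ends I i k = {u \<in> words_not_from I i k. last u \<noteq> i}"

lemma finite_words: "finite I \<Longrightarrow> finite (words I k)"
  unfolding words_def by (rule finite_lists_length_eq)

lemma finite_words_not_from: "finite I \<Longrightarrow> finite (words_not_from I i k)"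
  by (simp add: words_not_from_def finite_words)

lemma finite_words_avoiding_ends: "finite I \<Longrightarrow> finite (words_avoiding_ends I i k)"
  by (simp add: words_avoiding_ends_def finite_words_not_from)

lemma words_0: "words I 0 = {[]}"
  by (auto simp: words_def)

lemma words_not_from_0: "words_not_from I i 0 = {}"
  by (auto simp: words_not_from_def words_def)

lemma words_not_from_Suc:
  "words_not_from I i (Suc k) = (\<lambda>(j, u). j # u) ` ((I - {i}) \<times> words I k)"
  by (auto simp: words_not_from_def words_def image_iff length_Suc_conv)

lemma words_Suc: "words I (Suc k) = (\<lambda>(j, u). j # u) ` (I \<times> words I k)"
  by (auto simp: words_def image_iff length_Suc_conv)

lemma sum_words_Suc:
  "sum F (words I (Suc k)) = (\<Sum>j\<in>I. \<Sum>u\<in>words I k. F (j # u))"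
  unfolding words_Suc
  by (subst sum.reindex) (auto simp: inj_on_def sum.cartesian_product intro!: sum.cong)

lemma sum_words_not_from_Suc:
  "sum F (words_not_from I i (Suc k)) = (\<Sum>j\<in>I - {i}. \<Sum>u\<in>words I k. F (j # u))"
  unfolding words_not_from_Suc
  by (subst sum.reindex) (auto simp: inj_on_def sum.cartesian_product intro!: sum.cong)

lemma sum_words_split_first:
  assumes "finite I" "i \<in> I"
  shows "sum F (words I (Suc k)) =
    sum F (words_not_from I i (Suc k)) + (\<Sum>u\<in>words I k. F (i # u))"
  using assms
  by (simp add: sum_words_Suc sum_words_not_from_Suc sum.remove[of I i] add.commute)

lemma words_not_from_split_last:
  assumes "i \<in> I"
  shows "words_not_from I i (Suc k) =
    words_avoiding_ends I i (Suc k) \<union> (\<lambda>v. v @ [i]) ` words_not_from I i k" (is "?L = ?R")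
proof
  show "?L \<subseteq> ?R"
  proof
    fix u assume u: "u \<in> ?L"
    show "u \<in> ?R"
    proof (cases "last u = i")
      case True
      have ne: "u \<noteq> []" using u by (simp add: words_not_from_def)
      then have eq: "u = butlast u @ [i]" using True append_butlast_last_id[of u] by simp
      have "butlast u \<noteq> []" using u eq by (auto simp: words_not_from_def)
      moreover have "hd (butlast u) \<noteq> i"
        using u eq calculation by (metis (mono_tags, lifting) hd_append mem_Collect_eq words_not_from_def)
      ultimately have "butlast u \<in> words_not_from I i k"
        using u by (auto simp: words_not_from_def words_def dest: in_set_butlastD)
      then show ?thesis using eq by blast
    next
      case False
      then show ?thesis using u by (simp add: words_avoiding_ends_def)
    qed
  qed
  show "?R \<subseteq> ?L"
    using assms by (auto simp: words_avoiding_ends_def words_not_from_def words_def)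
qed

lemma sum_words_not_from_split_last:
  assumes "finite I" "i \<in> I"
  shows "sum F (words_not_from I i (Suc k)) =
    sum F (words_avoiding_ends I i (Suc k)) + (\<Sum>v\<in>words_not_from I i k. F (v @ [i]))"
proof -
  have "sum F (words_not_from I i (Suc k)) =
      sum F (words_avoiding_ends I i (Suc k)) + sum F ((\<lambda>v. v @ [i]) ` words_not_from I i k)"
    unfolding words_not_from_split_last[OF assms(2)]
    by (rule sum.union_disjoint)
      (auto simp: assms finite_words_not_from finite_words_avoiding_ends words_avoiding_ends_def)
  also have "sum F ((\<lambda>v. v @ [i]) ` words_not_from I i k) = (\<Sum>v\<in>words_not_from I i k. F (v @ [i]))"
    by (subst sum.reindex) (auto simp: inj_on_def)
  finally show ?thesis .
qed

text \<open>
  The run \<open>i^j\<close> already read is kept as an argument, so that absorbing one more letter \<open>i\<close> only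
  changes \<open>j\<close>; then the induction is on the length of the unread part.
\<close>

lemma sum_words_by_leading_run:
  assumes "finite I" "i \<in> I"
  shows "(\<Sum>u\<in>words I k. F (replicate j i @ u)) =
    F (replicate (j + k) i) + (\<Sum>q<k. \<Sum>v\<in>words_not_from I i (k - q). F (replicate (j + q) i @ v))"
proof (induction k arbitrary: j)
  case 0
  then show ?case by (simp add: words_0)
next
  case (Suc k)
  have run: "replicate j i @ i # u = replicate (Suc j) i @ u" for u
    by (simp add: replicate_app_Cons_same)
  have "(\<Sum>u\<in>words I (Suc k). F (replicate j i @ u)) =
      (\<Sum>v\<in>words_not_from I i (Suc k). F (replicate j i @ v)) +
      (\<Sum>u\<in>words I k. F (replicate (Suc j) i @ u))"
    by (subst sum_words_split_first[OF assms]) (simp only: run)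
  then show ?case
    unfolding Suc.IH by (simp add: sum.lessThan_Suc_shift add_ac del: sum.lessThan_Suc)
qed

text \<open>
  The weight \<open>F l v\<close> stands for the value of \<open>v\<close> together with \<open>l\<close> letters \<open>i\<close> that have been moved
  away from its end.  For \<open>\<phi>\<close> they stay behind \<open>v\<close>; for the tracial \<open>\<omega>\<close> they join the run
  in front of \<open>v\<close>.  One lemma covers both.
\<close>

lemma sum_words_not_from_by_final_run:
  fixes F :: "nat \<Rightarrow> 'k list \<Rightarrow> 'b::comm_semiring_0"
  assumes "finite I" "i \<in> I"
    and absorb: "\<And>l v. F l (v @ [i]) = F (Suc l) v"
    and factor: "\<And>l r v. v \<in> words_avoiding_ends I i r \<Longrightarrow> F l v = c l * \<Phi> v"
  shows "sum (F l) (words_not_from I i k) =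
    (\<Sum>q<k. c (l + q) * sum \<Phi> (words_avoiding_ends I i (k - q)))"
proof (induction k arbitrary: l)
  case 0
  then show ?case by (simp add: words_not_from_0)
next
  case (Suc k)
  have "sum (F l) (words_avoiding_ends I i (Suc k)) =
      c l * sum \<Phi> (words_avoiding_ends I i (Suc k))"
    by (simp add: factor sum_distrib_left)
  then show ?case
    by (simp add: sum_words_not_from_split_last[OF assms(1,2)] absorb Suc.IH
        sum.lessThan_Suc_shift del: sum.lessThan_Suc)
qed

section \<open>Moments of words\<close>

text \<open>
  With \<open>n\<close> letters whose runs of length \<open>p\<close> have moment \<open>m p\<close>, this is the sum of the word
  moments over the words of length \<open>k\<close> that do not start with a given letter: \<open>n - 1\<close>
  letters are left for the first run, and its letter is the forbidden one for the rest of the word.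
\<close>

fun boolean_sum :: "nat \<Rightarrow> (nat \<Rightarrow> complex) \<Rightarrow> nat \<Rightarrow> complex" where
  "boolean_sum n m 0 = 1"
| "boolean_sum n m (Suc k) = (of_nat n - 1) * (\<Sum>q\<le>k. m (Suc q) * boolean_sum n m (k - q))"

text \<open>
  The same sum over the words that also do not end with the given letter.  It arises
  by subtracting the words that end with a run of \<open>q + 1\<close> copies of that letter.
\<close>

fun two_sided_sum :: "nat \<Rightarrow> (nat \<Rightarrow> complex) \<Rightarrow> nat \<Rightarrow> complex" where
  "two_sided_sum n m 0 = 1"
| "two_sided_sum n m (Suc k) =
    boolean_sum n m (Suc k) - (\<Sum>q<k. m (Suc q) * two_sided_sum n m (k - q))"

text \<open>
  What the counting needs from cyclic-Boolean independence.  The empty word, which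
  has no counterpart in an algebra without unit, gets \<open>\<Phi>\<close>-value \<open>1\<close>; by \<open>Phi_run\<close> this
  forces \<open>m 0 = 1\<close> as soon as there is a letter.
\<close>

locale cyclic_boolean_word_moments =
  fixes I :: "'k set" and \<Phi> \<Omega> :: "'k list \<Rightarrow> complex" and m w :: "nat \<Rightarrow> complex"
  assumes finite_letters: "finite I"
    and Phi_Nil: "\<Phi> [] = 1"
    and Phi_append: "\<lbrakk>set u \<subseteq> I; set v \<subseteq> I; u \<noteq> []; v \<noteq> []; last u \<noteq> hd v\<rbrakk>
      \<Longrightarrow> \<Phi> (u @ v) = \<Phi> u * \<Phi> v"
    and Omega_append: "\<lbrakk>set u \<subseteq> I; set v \<subseteq> I; u \<noteq> []; v \<noteq> []; last u \<noteq> hd v; last v \<noteq> hd u\<rbrakk>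
      \<Longrightarrow> \<Omega> (u @ v) = \<Phi> u * \<Phi> v"
    and Omega_rotate: "\<lbrakk>set u \<subseteq> I; i \<in> I\<rbrakk> \<Longrightarrow> \<Omega> (u @ [i]) = \<Omega> (i # u)"
    and Phi_run: "i \<in> I \<Longrightarrow> \<Phi> (replicate j i) = m j"
    and Omega_run: "i \<in> I \<Longrightarrow> j \<ge> 1 \<Longrightarrow> \<Omega> (replicate j i) = w j"
begin

lemma Phi_leading_run:
  assumes "i \<in> I" "v \<in> words_not_from I i k"
  shows "\<Phi> (replicate j i @ v) = m j * \<Phi> v"
proof (cases "j = 0")
  case True
  then show ?thesis using Phi_Nil Phi_run[OF assms(1), of 0] by simp
next
  case False
  then have "\<Phi> (replicate j i @ v) = \<Phi> (replicate j i) * \<Phi> v"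
    using assms by (intro Phi_append) (auto simp: words_not_from_def words_def)
  then show ?thesis by (simp add: Phi_run assms)
qed

lemma Phi_final_run:
  assumes "i \<in> I" "v \<in> words_avoiding_ends I i k"
  shows "\<Phi> (v @ replicate j i) = m j * \<Phi> v"
proof (cases "j = 0")
  case True
  then show ?thesis using Phi_Nil Phi_run[OF assms(1), of 0] by simp
next
  case False
  then have "\<Phi> (v @ replicate j i) = \<Phi> v * \<Phi> (replicate j i)"
    using assms
    by (intro Phi_append) (auto simp: words_avoiding_ends_def words_not_from_def words_def)
  then show ?thesis by (simp add: Phi_run assms)
qed

lemma Omega_leading_run:
  assumes "i \<in> I" "v \<in> words_avoiding_ends I i k"
  shows "\<Omega> (replicate (Suc j) i @ v) = m (Suc j) * \<Phi> v"
proof -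
  have "\<Omega> (replicate (Suc j) i @ v) = \<Phi> (replicate (Suc j) i) * \<Phi> v"
    using assms
    by (intro Omega_append)
      (auto simp: words_avoiding_ends_def words_not_from_def words_def simp del: replicate_Suc)
  then show ?thesis by (simp only: Phi_run assms)
qed

lemma sum_Phi_leading_letter:
  assumes i: "i \<in> I"
    and not_from: "\<And>r. r \<ge> 1 \<Longrightarrow> r \<le> k \<Longrightarrow> sum \<Phi> (words_not_from I i r) = g r" and "g 0 = 1"
  shows "(\<Sum>u\<in>words I k. \<Phi> (i # u)) = (\<Sum>q\<le>k. m (Suc q) * g (k - q))"
proof -
  have "(\<Sum>u\<in>words I k. \<Phi> (i # u)) = (\<Sum>u\<in>words I k. \<Phi> (replicate 1 i @ u))"
    by simp
  also have "\<dots> = m (1 + k) +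
      (\<Sum>q<k. \<Sum>v\<in>words_not_from I i (k - q). \<Phi> (replicate (1 + q) i @ v))"
    unfolding sum_words_by_leading_run[OF finite_letters i] Phi_run[OF i] ..
  also have "(\<Sum>q<k. \<Sum>v\<in>words_not_from I i (k - q). \<Phi> (replicate (1 + q) i @ v)) =
      (\<Sum>q<k. m (1 + q) * g (k - q))"
  proof (intro sum.cong refl)
    fix q assume "q \<in> {..<k}"
    have "(\<Sum>v\<in>words_not_from I i (k - q). \<Phi> (replicate (1 + q) i @ v)) =
        m (1 + q) * sum \<Phi> (words_not_from I i (k - q))"
      unfolding sum_distrib_left by (intro sum.cong refl Phi_leading_run[OF i])
    also have "\<dots> = m (1 + q) * g (k - q)"
      using \<open>q \<in> {..<k}\<close> by (simp add: not_from)
    finally show "(\<Sum>v\<in>words_not_from I i (k - q). \<Phi> (replicate (1 + q) i @ v)) =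
        m (1 + q) * g (k - q)" .
  qed
  finally show ?thesis
    using \<open>g 0 = 1\<close> by (simp add: lessThan_Suc_atMost[symmetric])
qed

lemma sum_Phi_words_not_from:
  assumes "i \<in> I" "k \<ge> 1"
  shows "sum \<Phi> (words_not_from I i k) = boolean_sum (card I) m k"
  using assms
proof (induction k arbitrary: i rule: less_induct)
  case (less k)
  then obtain k' where k: "k = Suc k'" by (cases k) auto
  have "sum \<Phi> (words_not_from I i k) =
      (\<Sum>j\<in>I - {i}. \<Sum>q\<le>k'. m (Suc q) * boolean_sum (card I) m (k' - q))"
    unfolding k sum_words_not_from_Suc
    by (intro sum.cong refl sum_Phi_leading_letter) (auto simp: k intro!: less.IH)
  moreover have "card I \<ge> 1"
    using less.prems finite_letters by (auto simp: Suc_le_eq card_gt_0_iff)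
  ultimately show ?case
    using less.prems finite_letters by (simp add: k card_Diff_singleton of_nat_diff)
qed

lemma sum_Phi_words:
  "sum \<Phi> (words I (Suc k)) =
    of_nat (card I) * (\<Sum>q\<le>k. m (Suc q) * boolean_sum (card I) m (k - q))"
proof -
  have "sum \<Phi> (words I (Suc k)) =
      (\<Sum>j\<in>I. \<Sum>q\<le>k. m (Suc q) * boolean_sum (card I) m (k - q))"
    unfolding sum_words_Suc
    by (intro sum.cong refl sum_Phi_leading_letter) (auto simp: sum_Phi_words_not_from)
  then show ?thesis by simp
qed

lemma sum_Phi_words_avoiding_ends:
  assumes i: "i \<in> I" and "k \<ge> 1"
  shows "sum \<Phi> (words_avoiding_ends I i k) = two_sided_sum (card I) m k"
  using assms(2)
proof (induction k rule: less_induct)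
  case (less k)
  then obtain k' where k: "k = Suc k'" by (cases k) auto
  have m0: "m 0 = 1" using Phi_Nil Phi_run[OF i, of 0] by simp
  have "sum \<Phi> (words_not_from I i k) = (\<Sum>v\<in>words_not_from I i k. \<Phi> (v @ replicate 0 i))"
    by simp
  also have "\<dots> = (\<Sum>q<k. m (0 + q) * sum \<Phi> (words_avoiding_ends I i (k - q)))"
    by (rule sum_words_not_from_by_final_run[OF finite_letters i])
      (auto simp: Phi_final_run[OF i])
  also have "\<dots> = sum \<Phi> (words_avoiding_ends I i k) +
      (\<Sum>q<k'. m (Suc q) * sum \<Phi> (words_avoiding_ends I i (k' - q)))"
    by (simp add: k sum.lessThan_Suc_shift m0 del: sum.lessThan_Suc)
  also have "(\<Sum>q<k'. m (Suc q) * sum \<Phi> (words_avoiding_ends I i (k' - q))) =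
      (\<Sum>q<k'. m (Suc q) * two_sided_sum (card I) m (k' - q))"
    by (intro sum.cong refl arg_cong2[where f = times] less.IH) (auto simp: k)
  finally show ?case
    using sum_Phi_words_not_from[OF i less.prems]
    by (simp add: k eq_diff_eq del: boolean_sum.simps)
qed

text \<open>
  Rotating the final run of \<open>v\<close> to the front lengthens the leading run from \<open>j + 1\<close> to \<open>j + q + 1\<close> and
  leaves a word that avoids the letter at both ends, as cyclic independence requires.
\<close>

lemma sum_Omega_leading_run:
  assumes i: "i \<in> I"
  shows "(\<Sum>v\<in>words_not_from I i k. \<Omega> (replicate (Suc j) i @ v)) =
    (\<Sum>q<k. m (Suc (j + q)) * two_sided_sum (card I) m (k - q))"
proof -
  \<comment> \<open>\<open>\<Omega>\<close> is cyclic only on words over \<open>I\<close>, whereas the weight must absorb letters of every word.\<close>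
  define F where "F = (\<lambda>l v. if set v \<subseteq> I then \<Omega> (replicate (Suc l) i @ v) else 0)"
  have "(\<Sum>v\<in>words_not_from I i k. \<Omega> (replicate (Suc j) i @ v)) = sum (F j) (words_not_from I i k)"
    by (intro sum.cong) (auto simp: F_def words_not_from_def words_def)
  also have "\<dots> = (\<Sum>q<k. m (Suc (j + q)) * sum \<Phi> (words_avoiding_ends I i (k - q)))"
  proof (rule sum_words_not_from_by_final_run[OF finite_letters i, where c = "\<lambda>l. m (Suc l)"])
    fix l v
    show "F l (v @ [i]) = F (Suc l) v"
      using Omega_rotate[of "replicate (Suc l) i @ v" i] i
      by (auto simp: F_def set_replicate_conv_if)
  next
    fix l r v assume v: "v \<in> words_avoiding_ends I i r"
    then have "set v \<subseteq> I" by (auto simp: words_avoiding_ends_def words_not_from_def words_def)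
    then show "F l v = m (Suc l) * \<Phi> v"
      using Omega_leading_run[OF i v] by (simp add: F_def)
  qed
  finally show ?thesis by (simp add: sum_Phi_words_avoiding_ends[OF i])
qed

text \<open>
  Here \<open>p + 1\<close> is the length of the first run and \<open>q\<close> that of a last run with the same letter,
  so a merged run of length \<open>r\<close> occurs \<open>r\<close> times as long as the rest of the word is nonempty.
\<close>

lemma sum_Omega_words:
  "sum \<Omega> (words I (Suc k)) = of_nat (card I) * (w (Suc k) +
    (\<Sum>p<k. \<Sum>q<k - p. m (Suc (p + q)) * two_sided_sum (card I) m (k - p - q)))"
proof -
  have "(\<Sum>u\<in>words I k. \<Omega> (i # u)) = w (Suc k) +
    (\<Sum>p<k. \<Sum>q<k - p. m (Suc (p + q)) * two_sided_sum (card I) m (k - p - q))" if i: "i \<in> I" for i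
  proof -
    have "(\<Sum>u\<in>words I k. \<Omega> (i # u)) = (\<Sum>u\<in>words I k. \<Omega> (replicate 1 i @ u))"
      by simp
    also have "\<dots> = w (1 + k) +
        (\<Sum>p<k. \<Sum>v\<in>words_not_from I i (k - p). \<Omega> (replicate (1 + p) i @ v))"
      unfolding sum_words_by_leading_run[OF finite_letters i] by (simp only: Omega_run[OF i] le_add1)
    finally show ?thesis by (simp only: plus_1_eq_Suc sum_Omega_leading_run[OF i])
  qed
  then show ?thesis by (simp add: sum_words_Suc)
qed

end

section \<open>Limits\<close>

definition scale :: "nat \<Rightarrow> complex" where
  "scale N = complex_of_real (1 / sqrt (real N))"

lemma scale_square: "N \<ge> 1 \<Longrightarrow> of_nat N * scale N ^ 2 = 1"
  by (simp add: scale_def power_divide flip: of_real_power)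

lemma scale_tendsto_0: "scale \<longlonglongrightarrow> 0"
proof -
  have "(\<lambda>N. 1 / sqrt (real N)) \<longlonglongrightarrow> 0"
    using tendsto_divide_0[OF tendsto_const[of 1]
        filterlim_at_top_imp_at_infinity[OF filterlim_compose[OF sqrt_at_top filterlim_real_sequentially]]]
    by (simp add: o_def)
  then have "(\<lambda>N. complex_of_real (1 / sqrt (real N))) \<longlonglongrightarrow> complex_of_real 0"
    by (rule tendsto_of_real)
  then show ?thesis by (simp add: scale_def[abs_def])
qed

text \<open>
  The weight of one run of length \<open>p\<close>, its letter being chosen freely.  For \<open>p = 1\<close> the factor
  \<open>N^(1/2)\<close> diverges, so centring is needed; for \<open>p = 2\<close> the powers of \<open>N\<close> cancel.
\<close>

lemma scaled_run_tendsto: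
  fixes m :: "nat \<Rightarrow> complex"
  assumes "m 1 = 0" "m 2 = 1" "p \<ge> 1"
  shows "(\<lambda>N. of_nat N * scale N ^ p * m p) \<longlonglongrightarrow> (if p = 2 then 1 else 0)"
proof (cases "p = 1")
  case True
  then show ?thesis using assms by simp
next
  case False
  then have "p \<ge> 2" using assms by simp
  then obtain r where p: "p = r + 2" by (metis add.commute le_Suc_ex)
  have "(\<lambda>N. scale N ^ r * m p) \<longlonglongrightarrow> 0 ^ r * m p"
    by (intro tendsto_mult tendsto_power tendsto_const scale_tendsto_0)
  also have "0 ^ r * m p = (if p = 2 then 1 else 0)"
    using assms by (auto simp: p power_0_left numeral_2_eq_2)
  finally have lim: "(\<lambda>N. scale N ^ r * m p) \<longlonglongrightarrow> (if p = 2 then 1 else 0)" .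
  have "\<forall>\<^sub>F N in sequentially. scale N ^ r * m p = of_nat N * scale N ^ p * m p"
    using eventually_ge_at_top[of 1]
  proof eventually_elim
    case (elim N)
    have "of_nat N * scale N ^ p * m p = (of_nat N * scale N ^ 2) * (scale N ^ r * m p)"
      by (simp add: p power_add power2_eq_square)
    then show ?case by (simp only: scale_square[OF elim] mult_1)
  qed
  with lim show ?thesis by (rule Lim_transform_eventually)
qed

lemma boolean_sum_tendsto:
  assumes m: "m 1 = 0" "m 2 = 1"
  shows "(\<lambda>N. scale N ^ k * boolean_sum N m k) \<longlonglongrightarrow> of_bool (even k)"
proof (induction k rule: less_induct)
  case (less k)
  show ?case
  proof (cases k)
    case 0
    then show ?thesis by simp
  next
    case (Suc r)
    have split: "scale N ^ k * boolean_sum N m k =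
        (\<Sum>q\<le>r. (of_nat N * scale N ^ Suc q * m (Suc q) - scale N ^ Suc q * m (Suc q)) *
          (scale N ^ (r - q) * boolean_sum N m (r - q)))" for N
      unfolding Suc boolean_sum.simps sum_distrib_left
      by (intro sum.cong refl) (auto dest!: le_Suc_ex simp: power_add algebra_simps)
    have "(\<lambda>N. scale N ^ k * boolean_sum N m k) \<longlonglongrightarrow>
        (\<Sum>q\<le>r. ((if Suc q = 2 then 1 else 0) - 0 ^ Suc q * m (Suc q)) * of_bool (even (r - q)))"
      unfolding split
      by (intro tendsto_sum tendsto_mult tendsto_diff scaled_run_tendsto[of m, OF m]
          tendsto_power tendsto_const scale_tendsto_0 less.IH) (auto simp: Suc)
    also have "(\<Sum>q\<le>r. ((if Suc q = 2 then 1 else 0) - 0 ^ Suc q * m (Suc q)) * of_bool (even (r - q)))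
        = (\<Sum>q\<le>r. if q = 1 then of_bool (even (r - 1)) else (0::complex))"
      by (intro sum.cong) auto
    also have "\<dots> = of_bool (even k)"
      by (cases r) (auto simp: Suc)
    finally show ?thesis .
  qed
qed

text \<open>
  The letter of the subtracted final run is prescribed, so no factor \<open>N\<close> compensates its
  normalisation and all subtracted terms vanish in the limit.
\<close>

lemma two_sided_sum_tendsto:
  assumes m: "m 1 = 0" "m 2 = 1"
  shows "(\<lambda>N. scale N ^ k * two_sided_sum N m k) \<longlonglongrightarrow> of_bool (even k)"
proof (induction k rule: less_induct)
  case (less k)
  show ?case
  proof (cases k)
    case 0
    then show ?thesis by simp
  next
    case (Suc r)
    have split: "scale N ^ k * two_sided_sum N m k = scale N ^ k * boolean_sum N m k -
        (\<Sum>q<r. (scale N ^ Suc q * m (Suc q)) * (scale N ^ (r - q) * two_sided_sum N m (r - q)))" for N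
    proof -
      have "scale N ^ k = scale N ^ Suc q * scale N ^ (r - q)" if "q < r" for q
        unfolding power_add[symmetric] using that by (simp add: Suc)
      then have "(\<Sum>q<r. (scale N ^ Suc q * m (Suc q)) * (scale N ^ (r - q) * two_sided_sum N m (r - q)))
        = scale N ^ k * (\<Sum>q<r. m (Suc q) * two_sided_sum N m (r - q))"
        unfolding sum_distrib_left by (intro sum.cong refl) (simp add: mult_ac)
      then show ?thesis by (simp add: Suc right_diff_distrib)
    qed
    have "(\<lambda>N. scale N ^ k * two_sided_sum N m k) \<longlonglongrightarrow>
        of_bool (even k) - (\<Sum>q<r. (0 ^ Suc q * m (Suc q)) * of_bool (even (r - q)))"
      unfolding split
      by (intro tendsto_sum tendsto_mult tendsto_diff boolean_sum_tendsto m
          tendsto_power tendsto_const scale_tendsto_0 less.IH) (auto simp: Suc)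
    then show ?thesis by simp
  qed
qed

lemma scaled_phi_moment_tendsto:
  assumes m: "m 1 = 0" "m 2 = 1"
  shows "(\<lambda>N. scale N ^ Suc k * (of_nat N * (\<Sum>q\<le>k. m (Suc q) * boolean_sum N m (k - q))))
    \<longlonglongrightarrow> of_bool (odd k)"
proof -
  have split: "scale N ^ Suc k * (of_nat N * (\<Sum>q\<le>k. m (Suc q) * boolean_sum N m (k - q))) =
      (\<Sum>q\<le>k. (of_nat N * scale N ^ Suc q * m (Suc q)) *
        (scale N ^ (k - q) * boolean_sum N m (k - q)))" for N
    unfolding sum_distrib_left
    by (intro sum.cong refl) (auto dest!: le_Suc_ex simp: power_add mult_ac)
  have "(\<lambda>N. scale N ^ Suc k * (of_nat N * (\<Sum>q\<le>k. m (Suc q) * boolean_sum N m (k - q))))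
    \<longlonglongrightarrow> (\<Sum>q\<le>k. (if Suc q = 2 then 1 else 0) * of_bool (even (k - q)))"
    unfolding split
    by (intro tendsto_sum tendsto_mult scaled_run_tendsto[of m, OF m] boolean_sum_tendsto m) auto
  also have "(\<Sum>q\<le>k. (if Suc q = 2 then 1 else 0) * of_bool (even (k - q))) =
      (\<Sum>q\<le>k. if q = 1 then of_bool (even (k - 1)) else (0::complex))"
    by (intro sum.cong) auto
  also have "\<dots> = of_bool (odd k)"
    by (cases k) auto
  finally show ?thesis .
qed

lemma scaled_omega_moment_tendsto:
  assumes m: "m 1 = 0" "m 2 = 1" and "k \<ge> 2"
  shows "(\<lambda>N. scale N ^ Suc k * (of_nat N * (w (Suc k) +
      (\<Sum>p<k. \<Sum>q<k - p. m (Suc (p + q)) * two_sided_sum N m (k - p - q)))))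
    \<longlonglongrightarrow> 2 * of_bool (odd k)"
proof -
  \<comment> \<open>The single-run term has the form treated in \<open>scaled_run_tendsto\<close>, apart from the values of \<open>w\<close> at
    \<open>1\<close> and \<open>2\<close>; as \<open>k + 1 \<ge> 3\<close>, these can be replaced.\<close>
  define w' where "w' p = (if p = 2 then 1 else if p = 1 then 0 else w p)" for p
  have w': "w' 1 = 0" "w' 2 = 1" "w' (Suc k) = w (Suc k)" using \<open>k \<ge> 2\<close> by (auto simp: w'_def)
  have split: "scale N ^ Suc k * (of_nat N * (w (Suc k) +
      (\<Sum>p<k. \<Sum>q<k - p. m (Suc (p + q)) * two_sided_sum N m (k - p - q)))) =
      of_nat N * scale N ^ Suc k * w' (Suc k) +
      (\<Sum>p<k. \<Sum>q<k - p. (of_nat N * scale N ^ Suc (p + q) * m (Suc (p + q))) *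
        (scale N ^ (k - p - q) * two_sided_sum N m (k - p - q)))" for N
  proof -
    have "(\<Sum>p<k. \<Sum>q<k - p. (of_nat N * scale N ^ Suc (p + q) * m (Suc (p + q))) *
        (scale N ^ (k - p - q) * two_sided_sum N m (k - p - q))) =
        scale N ^ Suc k * (of_nat N *
        (\<Sum>p<k. \<Sum>q<k - p. m (Suc (p + q)) * two_sided_sum N m (k - p - q)))"
      unfolding sum_distrib_left
    proof (intro sum.cong refl)
      fix p q assume "p \<in> {..<k}" "q \<in> {..<k - p}"
      then have "p + q \<le> k" by auto
      then obtain d where "k = p + q + d" using le_Suc_ex[of "p + q" k] by blast
      then show "of_nat N * scale N ^ Suc (p + q) * m (Suc (p + q)) *
          (scale N ^ (k - p - q) * two_sided_sum N m (k - p - q)) =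
          scale N ^ Suc k * (of_nat N * (m (Suc (p + q)) * two_sided_sum N m (k - p - q)))"
        by (simp add: power_add mult_ac)
    qed
    then show ?thesis by (simp only: w') (simp add: algebra_simps)
  qed
  have "(\<lambda>N. scale N ^ Suc k * (of_nat N * (w (Suc k) +
      (\<Sum>p<k. \<Sum>q<k - p. m (Suc (p + q)) * two_sided_sum N m (k - p - q)))))
    \<longlonglongrightarrow> (if Suc k = 2 then 1 else 0) +
      (\<Sum>p<k. \<Sum>q<k - p. (if Suc (p + q) = 2 then 1 else 0) * of_bool (even (k - p - q)))"
    unfolding split
    by (intro tendsto_add tendsto_sum tendsto_mult scaled_run_tendsto[of m, OF m]
        scaled_run_tendsto[of w', OF w'(1,2)] two_sided_sum_tendsto m) auto
  also have "(if Suc k = 2 then 1 else 0) +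
      (\<Sum>p<k. \<Sum>q<k - p. (if Suc (p + q) = 2 then 1 else 0) * of_bool (even (k - p - q))) =
      (2 * of_bool (odd k) :: complex)"
  proof -
    obtain r where k: "k = r + 2" using \<open>k \<ge> 2\<close> by (metis add.commute le_Suc_ex)
    have odd_pred: "even (k - Suc 0) \<longleftrightarrow> odd k"
      by (simp add: k)
    \<comment> \<open>Only \<open>(p, q) = (0, 1)\<close> and \<open>(p, q) = (1, 0)\<close> give a merged run of length \<open>2\<close>.\<close>
    have "(\<Sum>p<k. \<Sum>q<k - p. (if Suc (p + q) = 2 then 1 else 0) * of_bool (even (k - p - q))) =
        (\<Sum>p<2. \<Sum>q<k - p. (if Suc (p + q) = 2 then 1 else 0) * of_bool (even (k - p - q)) :: complex)"
      using \<open>k \<ge> 2\<close> by (intro sum.mono_neutral_right) auto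
    also have "\<dots> = (\<Sum>p<2. \<Sum>q<k - p. if q = 1 - p then of_bool (odd k) else 0)"
      by (intro sum.cong refl) (auto simp: less_2_cases_iff odd_pred)
    also have "\<dots> = 2 * of_bool (odd k)"
      by (simp add: numeral_2_eq_2 k)
    finally show ?thesis using \<open>k \<ge> 2\<close> by simp
  qed
  finally show ?thesis .
qed

section \<open>From the algebra to words\<close>

context star_algebra
begin

lemma word_prod_single: "word_prod A [x] = x"
  by (simp add: word_prod_def)

lemma foldl_mult:
  assumes "x \<in> carrier A" "y \<in> carrier A" "set ys \<subseteq> carrier A"
  shows "foldl (\<otimes>) (x \<otimes> y) ys = x \<otimes> foldl (\<otimes>) y ys"
  using assms(2,3) by (induction ys arbitrary: y) (auto simp: mult_assoc[OF assms(1)] mult_closed)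

lemma foldl_closed:
  "x \<in> carrier A \<Longrightarrow> set ys \<subseteq> carrier A \<Longrightarrow> foldl (\<otimes>) x ys \<in> carrier A"
  by (induction ys arbitrary: x) (auto simp: mult_closed)

lemma word_prod_closed:
  "xs \<noteq> [] \<Longrightarrow> set xs \<subseteq> carrier A \<Longrightarrow> word_prod A xs \<in> carrier A"
  by (cases xs) (auto simp: word_prod_def foldl_closed)

lemma word_prod_Cons:
  "xs \<noteq> [] \<Longrightarrow> x \<in> carrier A \<Longrightarrow> set xs \<subseteq> carrier A \<Longrightarrow> word_prod A (x # xs) = x \<otimes> word_prod A xs"
  by (cases xs) (auto simp: word_prod_def foldl_mult)

lemma word_prod_append:
  assumes "xs \<noteq> []" "ys \<noteq> []" "set xs \<subseteq> carrier A" "set ys \<subseteq> carrier A"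
  shows "word_prod A (xs @ ys) = word_prod A xs \<otimes> word_prod A ys"
  using assms(1,3)
proof (induction xs rule: list_nonempty_induct)
  case (single x)
  then show ?case using assms by (simp add: word_prod_Cons word_prod_single)
next
  case (cons x xs)
  then show ?case
    using assms by (simp add: word_prod_Cons mult_assoc word_prod_closed)
qed

lemma linear_functional_finsum:
  assumes f: "linear_functional A f" and "finite I" and "b ` I \<subseteq> carrier A"
  shows "f (\<Oplus>i\<in>I. b i) = (\<Sum>i\<in>I. f (b i))"
  using assms(2,3)
proof (induction I rule: finite_induct)
  case empty
  have "f (\<zero> \<oplus> \<zero>) = f \<zero> + f \<zero>"
    using f unfolding linear_functional_def by (meson zero_closed)
  then show ?case by simp
next
  case (insert i I)
  have b: "b \<in> I \<rightarrow> carrier A" "b i \<in> carrier A" using insert.prems by auto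
  moreover have "(\<Oplus>i\<in>I. b i) \<in> carrier A" using b by (intro finsum_closed)
  ultimately have "f (b i \<oplus> (\<Oplus>i\<in>I. b i)) = f (b i) + f (\<Oplus>i\<in>I. b i)"
    using f by (simp add: linear_functional_def)
  then show ?case using insert b by simp
qed

lemma linear_functional_foldl:
  assumes "linear_functional A f" "set ys \<subseteq> carrier A"
  shows "linear_functional A (\<lambda>y. f (foldl (\<otimes>) y ys))"
  using assms
proof (induction ys arbitrary: f rule: rev_induct)
  case (snoc z ys)
  have "linear_functional A (\<lambda>y. f (y \<otimes> z))"
    using snoc.prems by (auto simp: linear_functional_def mult_l_distr smult_mult_l mult_closed)
  then show ?case using snoc by simp
qed simp

lemma linear_functional_left_mult:
  "linear_functional A f \<Longrightarrow> x \<in> carrier A \<Longrightarrow> linear_functional A (\<lambda>y. f (x \<otimes> y))"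
  by (auto simp: linear_functional_def mult_r_distr smult_mult_r mult_closed)

lemma linear_functional_scaled_sum:
  assumes f: "linear_functional A f" and I: "finite I" "b ` I \<subseteq> carrier A"
  shows "f (c \<odot> (\<Oplus>i\<in>I. b i)) = c * (\<Sum>i\<in>I. f (b i))"
proof -
  have "(\<Oplus>i\<in>I. b i) \<in> carrier A" using I by (intro finsum_closed) auto
  then have "f (c \<odot> (\<Oplus>i\<in>I. b i)) = c * f (\<Oplus>i\<in>I. b i)"
    using f by (simp add: linear_functional_def)
  then show ?thesis using linear_functional_finsum[OF assms] by simp
qed

text \<open>
  The prefix \<open>x\<close> holds the factors multiplied so far.  It stands in for the missing unit, which would
  otherwise start the induction.
\<close>

lemma foldl_power_expand:
  assumes f: "linear_functional A f" and I: "finite I" "b ` I \<subseteq> carrier A" and "x \<in> carrier A"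
    and s: "s = c \<odot> (\<Oplus>i\<in>I. b i)"
  shows "f (foldl (\<otimes>) x (replicate k s)) = c ^ k * (\<Sum>u\<in>words I k. f (foldl (\<otimes>) x (map b u)))"
  using \<open>x \<in> carrier A\<close>
proof (induction k arbitrary: x)
  case 0
  then show ?case by (simp add: words_0)
next
  case (Suc k)
  have "(\<Oplus>i\<in>I. b i) \<in> carrier A" using I by (intro finsum_closed) auto
  then have "s \<in> carrier A" unfolding s by (intro smult_closed) (auto simp: ring_of_type_algebra_def)
  then have "f (foldl (\<otimes>) x (replicate (Suc k) s)) =
      c ^ k * (\<Sum>u\<in>words I k. f (foldl (\<otimes>) (x \<otimes> s) (map b u)))"
    using Suc.IH[of "x \<otimes> s"] Suc.prems by (simp add: mult_closed)
  also have "(\<Sum>u\<in>words I k. f (foldl (\<otimes>) (x \<otimes> s) (map b u))) =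
      (\<Sum>u\<in>words I k. c * (\<Sum>i\<in>I. f (foldl (\<otimes>) (x \<otimes> b i) (map b u))))"
  proof (intro sum.cong refl)
    fix u assume "u \<in> words I k"
    then have "set (map b u) \<subseteq> carrier A" using I by (auto simp: words_def)
    from linear_functional_scaled_sum[OF
        linear_functional_left_mult[OF linear_functional_foldl[OF f this] Suc.prems] I]
    show "f (foldl (\<otimes>) (x \<otimes> s) (map b u)) = c * (\<Sum>i\<in>I. f (foldl (\<otimes>) (x \<otimes> b i) (map b u)))"
      unfolding s .
  qed
  also have "\<dots> = c * (\<Sum>u\<in>words I (Suc k). f (foldl (\<otimes>) x (map b u)))"
    by (subst sum_words_Suc, subst sum.swap) (simp add: sum_distrib_left)
  finally show ?case by simp
qed

lemma power_expand:
  assumes f: "linear_functional A f" and I: "finite I" "b ` I \<subseteq> carrier A"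
    and s: "s = c \<odot> (\<Oplus>i\<in>I. b i)"
  shows "f (pos_power A s (Suc k)) = c ^ Suc k * (\<Sum>u\<in>words I (Suc k). f (word_prod A (map b u)))"
proof -
  define F where "F y = (\<Sum>u\<in>words I k. f (foldl (\<otimes>) y (map b u)))" for y
  have car: "(\<Oplus>i\<in>I. b i) \<in> carrier A" using I by (intro finsum_closed) auto
  then have "s \<in> carrier A" unfolding s by (intro smult_closed) (auto simp: ring_of_type_algebra_def)
  then have "f (pos_power A s (Suc k)) = c ^ k * F s"
    using foldl_power_expand[OF f I _ s] by (simp add: pos_power_def word_prod_def F_def)
  also have "F s = c * (\<Sum>i\<in>I. F (b i))"
  proof -
    have "linear_functional A F"
    proof -
      have "linear_functional A (\<lambda>y. f (foldl (\<otimes>) y (map b u)))" if "u \<in> words I k" for u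
        using that I by (intro linear_functional_foldl f) (auto simp: words_def)
      then show ?thesis
        by (simp add: linear_functional_def F_def sum.distrib sum_distrib_left)
    qed
    from linear_functional_scaled_sum[OF this I] show ?thesis unfolding s .
  qed
  also have "(\<Sum>i\<in>I. F (b i)) = (\<Sum>u\<in>words I (Suc k). f (word_prod A (map b u)))"
    by (simp add: F_def sum_words_Suc word_prod_def)
  finally show ?thesis by (simp add: mult_ac)
qed

text \<open>
  Collecting each run into one element of the corresponding subalgebra makes neighbouring
  indices distinct, which is the form in which independence is assumed.  The first and last letters are
  recorded so that such decompositions can be concatenated.
\<close>

lemma word_prod_blocks:
  assumes B: "\<And>i. i \<in> K \<Longrightarrow> star_subalgebra A (B i)" "\<And>i. i \<in> K \<Longrightarrow> a i \<in> B i"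
    and "u \<noteq> []" "set u \<subseteq> K"
  shows "\<exists>ks xs. ks \<noteq> [] \<and> set ks \<subseteq> K \<and> distinct_adj ks \<and> list_all2 (\<lambda>x k. x \<in> B k) xs ks \<and>
    hd ks = hd u \<and> last ks = last u \<and> word_prod A xs = word_prod A (map a u)"
  using assms(3,4)
proof (induction u rule: list_nonempty_induct)
  case (single i)
  then show ?case using B by (intro exI[of _ "[i]"] exI[of _ "[a i]"]) auto
next
  case (cons i u)
  have car: "B j \<subseteq> carrier A" if "j \<in> K" for j
    using B(1)[OF that] by (simp add: star_subalgebra_def)
  have i: "i \<in> K" "a i \<in> B i" "a i \<in> carrier A" and u: "set (map a u) \<subseteq> carrier A"
    using cons.prems B car by fastforce+
  obtain ks xs where ks: "ks \<noteq> []" "set ks \<subseteq> K" "distinct_adj ks"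
      "list_all2 (\<lambda>x k. x \<in> B k) xs ks" "hd ks = hd u" "last ks = last u"
      "word_prod A xs = word_prod A (map a u)"
    using cons by auto
  obtain k ks' x xs' where eq: "ks = k # ks'" "xs = x # xs'"
    using ks(1,4) by (cases ks; cases xs) auto
  have xs: "set xs \<subseteq> carrier A"
    using ks(2,4) car by (fastforce simp: list_all2_conv_all_nth in_set_conv_nth)
  have prod: "word_prod A (map a (i # u)) = a i \<otimes> word_prod A xs"
    using cons.hyps u i by (simp add: word_prod_Cons ks(7))
  show ?case
  proof (cases "k = i")
    case True
    have "a i \<otimes> x \<in> B i"
      using B(1)[OF i(1)] i(2) ks(4) eq True by (auto simp: star_subalgebra_def)
    moreover have "word_prod A ((a i \<otimes> x) # xs') = a i \<otimes> word_prod A xs"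
      using xs eq i by (simp add: word_prod_def foldl_mult)
    ultimately show ?thesis
      using ks eq True cons.hyps prod
      by (intro exI[of _ ks] exI[of _ "(a i \<otimes> x) # xs'"]) auto
  next
    case False
    then show ?thesis
      using ks eq cons.hyps prod i xs
      by (intro exI[of _ "i # ks"] exI[of _ "a i # xs"]) (auto simp: word_prod_Cons)
  qed
qed

end

context cyclic_ncps
begin

definition word_moment :: "('k \<Rightarrow> 'a) \<Rightarrow> 'k list \<Rightarrow> complex" where
  "word_moment a u = (if u = [] then 1 else \<phi> (word_prod A (map a u)))"

text \<open>
  If \<open>u\<close> and \<open>v\<close> do not share a letter at the junction, then the runs of \<open>u v\<close> are those of \<open>u\<close>
  followed by those of \<open>v\<close>, so both sides are the same product over runs.
\<close>

lemma cyclic_boolean_word_factorization: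
  assumes indep: "cyclic_boolean_indep_elems A \<phi> \<omega> K a"
    and u: "u \<noteq> []" "set u \<subseteq> K" and v: "v \<noteq> []" "set v \<subseteq> K" and uv: "last u \<noteq> hd v"
  shows "\<phi> (word_prod A (map a (u @ v))) = \<phi> (word_prod A (map a u)) * \<phi> (word_prod A (map a v))"
    and "last v \<noteq> hd u \<Longrightarrow>
      \<omega> (word_prod A (map a (u @ v))) = \<phi> (word_prod A (map a u)) * \<phi> (word_prod A (map a v))"
proof -
  define B where "B k = gen_star_subalgebra A (a k)" for k
  note ind = indep[unfolded cyclic_boolean_indep_elems_def cyclic_boolean_indep_def, folded B_def]
  have B: "\<And>i. i \<in> K \<Longrightarrow> star_subalgebra A (B i)" "\<And>i. i \<in> K \<Longrightarrow> a i \<in> B i"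
    using ind by (auto simp: B_def gen_star_subalgebra_def)
  have car: "set xs \<subseteq> carrier A" if "set ks \<subseteq> K" "list_all2 (\<lambda>x k. x \<in> B k) xs ks" for xs ks
    using that B by (fastforce simp: list_all2_conv_all_nth in_set_conv_nth star_subalgebra_def)
  have letters: "set (map a t) \<subseteq> carrier A" if "set t \<subseteq> K" for t
    using that B by (fastforce simp: star_subalgebra_def)
  \<comment> \<open>Independence speaks of at least two factors; a single block is trivial.\<close>
  have phi: "\<phi> (word_prod A xs) = prod_list (map \<phi> xs)"
    if "ks \<noteq> []" "set ks \<subseteq> K" "distinct_adj ks" "list_all2 (\<lambda>x k. x \<in> B k) xs ks" for ks xs
  proof (cases "length ks \<ge> 2")
    case True
    then show ?thesis using ind that by blast
  next
    case False
    then have "length ks = 1" using that(1) by (cases ks) (auto simp: not_le less_Suc_eq)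
    then have "length xs = 1" using that(4) by (simp add: list_all2_lengthD)
    then show ?thesis by (auto simp: length_Suc_conv word_prod_single)
  qed
  obtain ks xs where ks: "ks \<noteq> []" "set ks \<subseteq> K" "distinct_adj ks"
      "list_all2 (\<lambda>x k. x \<in> B k) xs ks" "hd ks = hd u" "last ks = last u"
      "word_prod A xs = word_prod A (map a u)"
    using word_prod_blocks[of K B, OF B u] by blast
  obtain ls ys where ls: "ls \<noteq> []" "set ls \<subseteq> K" "distinct_adj ls"
      "list_all2 (\<lambda>x k. x \<in> B k) ys ls" "hd ls = hd v" "last ls = last v"
      "word_prod A ys = word_prod A (map a v)"
    using word_prod_blocks[of K B, OF B v] by blast
  have ne: "xs \<noteq> []" "ys \<noteq> []" using ks(1,4) ls(1,4) by auto
  have "word_prod A (xs @ ys) = word_prod A xs \<otimes> word_prod A ys"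
    using ne car ks ls by (intro word_prod_append) blast+
  also have "\<dots> = word_prod A (map a (u @ v))"
    using u v letters by (simp add: ks(7) ls(7) word_prod_append del: set_map)
  finally have prod: "word_prod A (map a (u @ v)) = word_prod A (xs @ ys)" by simp
  have rhs: "\<phi> (word_prod A (map a u)) * \<phi> (word_prod A (map a v)) = prod_list (map \<phi> (xs @ ys))"
    using phi[OF ks(1-4)] phi[OF ls(1-4)] by (simp add: ks(7) ls(7))
  have len: "length (ks @ ls) \<ge> 2" using ks(1) ls(1) by (cases ks; cases ls) auto
  have K: "set (ks @ ls) \<subseteq> K" using ks(2) ls(2) by simp
  have adj: "distinct_adj (ks @ ls)"
    using ks ls uv by (simp add: distinct_adj_append_iff)
  have mem: "list_all2 (\<lambda>x k. x \<in> B k) (xs @ ys) (ks @ ls)"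
    using ks(4) ls(4) by (rule list_all2_appendI)
  show "\<phi> (word_prod A (map a (u @ v))) = \<phi> (word_prod A (map a u)) * \<phi> (word_prod A (map a v))"
    unfolding prod rhs using ind len K adj mem by blast
  assume "last v \<noteq> hd u"
  then have "last (ks @ ls) \<noteq> hd (ks @ ls)" using ks ls by simp
  then show "\<omega> (word_prod A (map a (u @ v))) =
      \<phi> (word_prod A (map a u)) * \<phi> (word_prod A (map a v))"
    unfolding prod rhs using ind len K adj mem by blast
qed

lemma cyclic_boolean_word_moments:
  assumes indep: "cyclic_boolean_indep_elems A \<phi> \<omega> K a" and "finite K"
    and a: "a ` K \<subseteq> carrier A"
    and m: "\<And>i j. i \<in> K \<Longrightarrow> j \<ge> 1 \<Longrightarrow> \<phi> (pos_power A (a i) j) = m j" "m 0 = 1"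
    and w: "\<And>i j. i \<in> K \<Longrightarrow> j \<ge> 1 \<Longrightarrow> \<omega> (pos_power A (a i) j) = w j"
  shows "cyclic_boolean_word_moments K (word_moment a) (\<lambda>u. \<omega> (word_prod A (map a u))) m w"
proof
  show "finite K" by fact
  show "word_moment a [] = 1" by (simp add: word_moment_def)
next
  fix u v assume "set u \<subseteq> K" "set v \<subseteq> K" "u \<noteq> []" "v \<noteq> []" "last u \<noteq> hd v"
  note uv = cyclic_boolean_word_factorization[OF indep this(3,1,4,2,5)]
  show "word_moment a (u @ v) = word_moment a u * word_moment a v"
    using uv(1) \<open>u \<noteq> []\<close> \<open>v \<noteq> []\<close> by (simp add: word_moment_def)
  show "\<omega> (word_prod A (map a (u @ v))) = word_moment a u * word_moment a v" if "last v \<noteq> hd u"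
    using uv(2)[OF that] \<open>u \<noteq> []\<close> \<open>v \<noteq> []\<close> by (simp add: word_moment_def)
next
  fix u i assume ui: "set u \<subseteq> K" "i \<in> K"
  show "\<omega> (word_prod A (map a (u @ [i]))) = \<omega> (word_prod A (map a (i # u)))"
  proof (cases "u = []")
    case False
    have i: "a i \<in> carrier A" and u: "set (map a u) \<subseteq> carrier A" using ui a by auto
    then have "word_prod A (map a (u @ [i])) = word_prod A (map a u) \<otimes> a i"
      using False by (simp add: word_prod_append word_prod_single del: set_map)
    moreover have "word_prod A (map a (i # u)) = a i \<otimes> word_prod A (map a u)"
      using False i u by (simp add: word_prod_Cons)
    ultimately show ?thesis
      using omega_tracial[OF word_prod_closed[OF _ u] i] False by simp
  qed simp
next
  fix i j assume i: "i \<in> K"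
  show "word_moment a (replicate j i) = m j"
    using m(1)[OF i, of j] m(2) by (cases j) (auto simp: word_moment_def pos_power_def)
  show "\<omega> (word_prod A (map a (replicate j i))) = w j" if "j \<ge> 1"
    using w[OF i that] by (simp add: pos_power_def)
qed

end

section \<open>The limit theorem\<close>

theorem theorem4p7:
  fixes A :: "nat \<Rightarrow> 'a star_alg"
    and \<phi> \<omega> :: "nat \<Rightarrow> 'a \<Rightarrow> complex"
    and a :: "nat \<Rightarrow> nat \<Rightarrow> 'a"
    and s :: "nat \<Rightarrow> 'a"
  assumes space: "\<And>N. N \<ge> 1 \<Longrightarrow> cyclic_ncps (A N) (\<phi> N) (\<omega> N)"
    and self_adj: "\<And>N i. i \<in> {1..N} \<Longrightarrow> self_adjoint (A N) (a N i)"
    and indep: "\<And>N. N \<ge> 1 \<Longrightarrow> cyclic_boolean_indep_elems (A N) (\<phi> N) (\<omega> N) {1..N} (a N)"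
    and phi_moments: "\<And>k N i M j. k \<ge> 1 \<Longrightarrow> i \<in> {1..N} \<Longrightarrow> j \<in> {1..M} \<Longrightarrow>
      \<phi> N (pos_power (A N) (a N i) k) = \<phi> M (pos_power (A M) (a M j) k)"
    and omega_moments: "\<And>k N i M j. k \<ge> 1 \<Longrightarrow> i \<in> {1..N} \<Longrightarrow> j \<in> {1..M} \<Longrightarrow>
      \<omega> N (pos_power (A N) (a N i) k) = \<omega> M (pos_power (A M) (a M j) k)"
    and omega_mean: "\<And>N i. i \<in> {1..N} \<Longrightarrow> \<omega> N (a N i) = 0"
    and phi_mean: "\<And>N i. i \<in> {1..N} \<Longrightarrow> \<phi> N (a N i) = 0"
    and phi_var: "\<And>N i. i \<in> {1..N} \<Longrightarrow> \<phi> N (pos_power (A N) (a N i) 2) = 1"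
    and s_eq: "\<And>N. N \<ge> 1 \<Longrightarrow>
      s N = complex_of_real (1 / sqrt (real N)) \<odot>\<^bsub>A N\<^esub> (\<Oplus>\<^bsub>A N\<^esub> i\<in>{1..N}. a N i)"
  shows "(\<forall>k\<ge>1. (\<lambda>N. \<phi> N (pos_power (A N) (s N) k)) \<longlonglongrightarrow> (if even k then 1 else 0)) \<and>
         (\<forall>k\<ge>3. (\<lambda>N. \<omega> N (pos_power (A N) (s N) k)) \<longlonglongrightarrow> (if even k then 2 else 0))"
proof -
  \<comment> \<open>The common moments, read off from the one-element family at \<open>N = 1\<close>.\<close>
  define m where "m = (\<lambda>j. if j = 0 then 1 else \<phi> 1 (pos_power (A 1) (a 1 1) j))"
  define w where "w = (\<lambda>j. \<omega> 1 (pos_power (A 1) (a 1 1) j))"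
  have m: "m 1 = 0" "m 2 = 1"
    using phi_mean[of 1 1] phi_var[of 1 1] by (auto simp: m_def pos_power_def word_prod_def)
  have powers: "\<phi> N (pos_power (A N) (s N) (Suc k)) =
        scale N ^ Suc k * (of_nat N * (\<Sum>q\<le>k. m (Suc q) * boolean_sum N m (k - q)))"
      "\<omega> N (pos_power (A N) (s N) (Suc k)) =
        scale N ^ Suc k * (of_nat N * (w (Suc k) +
          (\<Sum>p<k. \<Sum>q<k - p. m (Suc (p + q)) * two_sided_sum N m (k - p - q))))"
    if N: "N \<ge> 1" for N k
  proof -
    interpret cyclic_ncps "A N" "\<phi> N" "\<omega> N" by (rule space[OF N])
    have a: "a N ` {1..N} \<subseteq> carrier (A N)" using self_adj by (auto simp: self_adjoint_def)
    interpret W: cyclic_boolean_word_moments "{1..N}" "word_moment (a N)"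
      "\<lambda>u. \<omega> N (word_prod (A N) (map (a N) u))" m w
    proof (rule cyclic_boolean_word_moments[OF indep[OF N] _ a])
      show "\<phi> N (pos_power (A N) (a N i) j) = m j" if "i \<in> {1..N}" "j \<ge> 1" for i j
        using phi_moments[OF that(2,1), of 1 1] that by (simp add: m_def)
      show "\<omega> N (pos_power (A N) (a N i) j) = w j" if "i \<in> {1..N}" "j \<ge> 1" for i j
        using omega_moments[OF that(2,1), of 1 1] by (simp add: w_def)
    qed (auto simp: m_def)
    have lin: "linear_functional (A N) (\<phi> N)" "linear_functional (A N) (\<omega> N)"
      using phi_positive omega_positive by (auto simp: positive_functional_def)
    note expand = power_expand[OF _ _ a s_eq[OF N, folded scale_def]]
    have "(\<Sum>u\<in>words {1..N} (Suc k). \<phi> N (word_prod (A N) (map (a N) u))) =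
        sum (word_moment (a N)) (words {1..N} (Suc k))"
      by (intro sum.cong) (auto simp: word_moment_def words_def)
    then show "\<phi> N (pos_power (A N) (s N) (Suc k)) =
        scale N ^ Suc k * (of_nat N * (\<Sum>q\<le>k. m (Suc q) * boolean_sum N m (k - q)))"
      using expand[OF lin(1)] W.sum_Phi_words[of k] by simp
    show "\<omega> N (pos_power (A N) (s N) (Suc k)) =
        scale N ^ Suc k * (of_nat N * (w (Suc k) +
          (\<Sum>p<k. \<Sum>q<k - p. m (Suc (p + q)) * two_sided_sum N m (k - p - q))))"
      using expand[OF lin(2)] W.sum_Omega_words[of k] by simp
  qed
  have "(\<lambda>N. \<phi> N (pos_power (A N) (s N) k)) \<longlonglongrightarrow> (if even k then 1 else 0)" if k1: "k \<ge> 1" for k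
  proof -
    obtain r where k: "k = Suc r" using k1 by (cases k) auto
    have "(\<lambda>N. \<phi> N (pos_power (A N) (s N) (Suc r))) \<longlonglongrightarrow> of_bool (odd r)"
      by (rule Lim_transform_eventually[OF scaled_phi_moment_tendsto[of m, OF m]])
        (use eventually_ge_at_top[of 1] in eventually_elim, simp only: powers)
    then show ?thesis by (auto simp: k)
  qed
  moreover have "(\<lambda>N. \<omega> N (pos_power (A N) (s N) k)) \<longlonglongrightarrow> (if even k then 2 else 0)" if k3: "k \<ge> 3" for k
  proof -
    obtain r where k: "k = Suc r" "r \<ge> 2" using k3 by (cases k) auto
    have "(\<lambda>N. \<omega> N (pos_power (A N) (s N) (Suc r))) \<longlonglongrightarrow> 2 * of_bool (odd r)"
      by (rule Lim_transform_eventually[OF scaled_omega_moment_tendsto[of m, OF m k(2)]])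
        (use eventually_ge_at_top[of 1] in eventually_elim, simp only: powers)
    then show ?thesis by (auto simp: k)
  qed
  ultimately show ?thesis by blast
qed

end
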